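(* Let $N$ be an abelian minimal normal subgroup of a finite group $G$ and let $g_1N,\dots,g_dN$ be a minimum generating set of $G/N$. We can find a minimum generating set for $G$ by testing at most $d(|N|-1)+1\leq d|N|$ elements of $G^d$.
   Context: For a finite group $H$, $d(H)$ is the smallest cardinality of a generating set of $H$; a minimum generating set of $H$ is a generating set of cardinality $d(H)$. Testing an element $(h_1,\dots,h_d)$ of $G^d$ means checking whether $\{h_1,\dots,h_d\}$ generates $G$.
   Formalization: The inequality d(|N|-1)+1 ≤ d|N| is asserted only for d ≥ 1, since for d = 0 (G = N of prime order) it would read 1 ≤ 0; the bound of d(|N|-1)+1 tests is proved for all d, including d = 0. *)

theory Defs
  imports "HOL-Algebra.Generated_Groups"
begin

definition generating_set :: "('a, 'b) monoid_scheme \<Rightarrow> 'a set \<Rightarrow> bool" where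
  "generating_set G S \<longleftrightarrow> S \<subseteq> carrier G \<and> generate G S = carrier G"

text \<open>For a finite group the set below is nonempty, since the carrier itself is a finite
  generating set.\<close>

definition gen_number :: "('a, 'b) monoid_scheme \<Rightarrow> nat" where
  "gen_number G = (LEAST k. \<exists>S. finite S \<and> card S = k \<and> generating_set G S)"

definition minimum_generating_set :: "('a, 'b) monoid_scheme \<Rightarrow> 'a set \<Rightarrow> bool" where
  "minimum_generating_set G S \<longleftrightarrow> finite S \<and> generating_set G S \<and> card S = gen_number G"

definition minimal_normal_subgroup :: "'a set \<Rightarrow> ('a, 'b) monoid_scheme \<Rightarrow> bool" where
  "minimal_normal_subgroup N G \<longleftrightarrow>
     N \<lhd> G \<and> N \<noteq> {\<one>\<^bsub>G\<^esub>} \<and> (\<forall>M. M \<lhd> G \<and> M \<subseteq> N \<longrightarrow> M = {\<one>\<^bsub>G\<^esub>} \<or> M = N)"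

definition tuples :: "('a, 'b) monoid_scheme \<Rightarrow> nat \<Rightarrow> 'a list set" where
  "tuples G d = {hs. length hs = d \<and> set hs \<subseteq> carrier G}"

text \<open>
  A procedure that searches for generators by testing tuples is an adaptive decision tree.
  Saying that for one fixed group some such tree finds a minimum generating set would be vacuous:
  the tree consisting of a correct answer performs no test.  What makes the number of tests
  meaningful is that a procedure is written once, before the group is known.  So its tests and its
  answer are group terms in variables, the variables stand for the group elements given as input,
  and the outcomes of the tests are all it ever learns about the group.  Evaluating terms is free.
\<close>

datatype 'v group_term =
    Var 'v
  | One
  | Mult "'v group_term" "'v group_term"
  | Inv "'v group_term"

primrec eval_term :: "('a, 'b) monoid_scheme \<Rightarrow> ('v \<Rightarrow> 'a) \<Rightarrow> 'v group_term \<Rightarrow> 'a" where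
  "eval_term G \<rho> (Var v) = \<rho> v"
| "eval_term G \<rho> One = \<one>\<^bsub>G\<^esub>"
| "eval_term G \<rho> (Mult s t) = eval_term G \<rho> s \<otimes>\<^bsub>G\<^esub> eval_term G \<rho> t"
| "eval_term G \<rho> (Inv t) = inv\<^bsub>G\<^esub> (eval_term G \<rho> t)"

text \<open>\<open>Test ts P Q\<close> tests the tuple denoted by \<open>ts\<close> and continues with \<open>P\<close> if its entries generate
  the group and with \<open>Q\<close> otherwise.\<close>

datatype 'v procedure =
    Return "'v group_term list"
  | Test "'v group_term list" "'v procedure" "'v procedure"

primrec result :: "('a, 'b) monoid_scheme \<Rightarrow> ('v \<Rightarrow> 'a) \<Rightarrow> 'v procedure \<Rightarrow> 'a list" where
  "result G \<rho> (Return ts) = map (eval_term G \<rho>) ts"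
| "result G \<rho> (Test ts P Q) =
     (if generating_set G (set (map (eval_term G \<rho>) ts)) then result G \<rho> P else result G \<rho> Q)"

text \<open>The tuples tested during the run, in order and with repetitions.\<close>

primrec tested :: "('a, 'b) monoid_scheme \<Rightarrow> ('v \<Rightarrow> 'a) \<Rightarrow> 'v procedure \<Rightarrow> 'a list list" where
  "tested G \<rho> (Return ts) = []"
| "tested G \<rho> (Test ts P Q) =
     map (eval_term G \<rho>) ts #
     (if generating_set G (set (map (eval_term G \<rho>) ts)) then tested G \<rho> P else tested G \<rho> Q)"

end

theory Submission
  imports Defs "HOL-Algebra.Zassenhaus"
begin

text \<open>Since \<open>N\<close> is abelian and minimal normal, a lift of a generating tuple of \<open>G Mod N\<close> either
  generates \<open>G\<close> or generates a complement of \<open>N\<close>. Relative to a complement generated by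
  \<open>g\<^sub>1, \<dots>, g\<^sub>d\<close>, the failing lifts \<open>g\<^sub>1 n\<^sub>1, \<dots>, g\<^sub>d n\<^sub>d\<close> correspond to crossed homomorphisms, so
  they form a subgroup of \<open>N\<^sup>d\<close>. Hence if the original tuple and all its modifications in a single
  entry fail, every lift fails, and by Gaschuetz's counting argument no \<open>d\<close> elements generate \<open>G\<close>.
  Adding any nontrivial element of \<open>N\<close> then gives a minimum generating set.\<close>

section \<open>Supplements of a normal subgroup and generation modulo it\<close>

text \<open>As \<open>H\<close> is normal, \<open>L <#> H\<close> is a subgroup; it contains
  \<open>M\<close> and \<open>H\<close>, hence everything they generate. This is how subgroups
  generated by lifts are recognised as supplements below.\<close>

lemma (in normal) set_mult_eq_carrier:
  assumes L: "subgroup L G" and M: "M \<subseteq> L <#> H" and gen: "generate G (M \<union> H) = carrier G"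
  shows "L <#> H = carrier G"
proof -
  have sub: "subgroup (L <#> H) G"
    using mult_norm_subgroup[OF normal_axioms L] commut_normal[OF L normal_axioms] by simp
  have "H \<subseteq> L <#> H"
    using subgroup.one_closed[OF L] subset by (force simp: set_mult_def)
  with M have "generate G (M \<union> H) \<subseteq> L <#> H"
    using generate_subgroup_incl[OF _ sub] by blast
  with gen subgroup.subset[OF sub] show ?thesis by blast
qed

text \<open>Turns generation of the quotient into a condition inside \<open>G\<close>. Forwards,
  every \<open>y\<close> shares its coset with some \<open>s\<close> in \<open>generate G S\<close>,
  so \<open>y = h \<otimes> s\<close>; backwards, \<open>generate G S\<close> is a supplement of
  \<open>H\<close> and so meets every coset.\<close>

lemma (in normal) generate_Mod_iff:
  assumes S: "S \<subseteq> carrier G"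
  shows "generating_set (G Mod H) ((\<lambda>g. g <# H) ` S) \<longleftrightarrow> generate G (S \<union> H) = carrier G"
proof -
  interpret q: group_hom G "G Mod H" "\<lambda>a. H #> a"
    using r_coset_hom_Mod factorgroup_is_group by (simp add: group_hom_def group_hom_axioms_def)
  have sub: "subgroup (generate G S) G" using S by (rule generate_is_subgroup)
  have SH: "S \<union> H \<subseteq> carrier G" using S subset by blast
  \<comment> \<open>The statement uses left cosets, the projection homomorphism right cosets;
    normality identifies them.\<close>
  have eq: "(\<lambda>g. g <# H) ` S = (\<lambda>g. H #> g) ` S"
    using S coset_eq by (intro image_cong) auto
  have carr: "carrier (G Mod H) = (\<lambda>g. H #> g) ` carrier G"
    by (auto simp: FactGroup_def RCOSETS_def)
  show ?thesis
  proof
    assume "generating_set (G Mod H) ((\<lambda>g. g <# H) ` S)"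
    then have im: "(\<lambda>g. H #> g) ` generate G S = (\<lambda>g. H #> g) ` carrier G"
      using q.generate_img[OF S] carr by (simp add: generating_set_def eq)
    have "y \<in> generate G (S \<union> H)" if y: "y \<in> carrier G" for y
    proof -
      obtain s where s: "s \<in> generate G S" "H #> y = H #> s" using im y by blast
      have "y \<in> H #> s" using rcos_self[OF y subgroup_axioms] s by simp
      then obtain h where h: "h \<in> H" "y = h \<otimes> s" by (auto simp: r_coset_def)
      have "s \<in> generate G (S \<union> H)" using s(1) mono_generate[of S "S \<union> H"] by blast
      then show ?thesis using h by (auto intro: generate.eng generate.incl)
    qed
    then show "generate G (S \<union> H) = carrier G" using generate_incl[OF SH] by blast
  next
    assume gen: "generate G (S \<union> H) = carrier G"
    have "S \<subseteq> generate G S <#> H"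
    proof
      fix s assume "s \<in> S"
      then have "s \<otimes> \<one> \<in> generate G S <#> H"
        using subgroup.one_closed[OF subgroup_axioms] generate.incl[of s S] unfolding set_mult_def by blast
      then show "s \<in> generate G S <#> H" using S \<open>s \<in> S\<close> by auto
    qed
    then have L: "generate G S <#> H = carrier G"
      by (rule set_mult_eq_carrier[OF sub _ gen])
    have "H #> y \<in> (\<lambda>g. H #> g) ` generate G S" if y: "y \<in> carrier G" for y
    proof -
      have "y \<in> H <#> generate G S" using y L commut_normal[OF sub normal_axioms] by simp
      then obtain h s where h: "h \<in> H" and s: "s \<in> generate G S" and yhs: "y = h \<otimes> s"
        by (auto simp: set_mult_def)
      have sc: "s \<in> carrier G" using s generate_incl[OF S] by blast
      have "y \<in> H #> s" using h yhs by (auto simp: r_coset_def)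
      then have "H #> s = H #> y" using sc subgroup_axioms by (intro repr_independence)
      then show ?thesis using s by auto
    qed
    then have "(\<lambda>g. H #> g) ` generate G S = carrier (G Mod H)"
      using carr generate_incl[OF S] by auto
    then show "generating_set (G Mod H) ((\<lambda>g. g <# H) ` S)"
      using q.generate_img[OF S] S carr by (auto simp: generating_set_def eq)
  qed
qed

lemma (in group) gen_number_le:
  assumes "finite S" "generating_set G S"
  shows "gen_number G \<le> card S"
  unfolding gen_number_def using assms by (intro Least_le) auto

lemma (in group) gen_number_attained:
  assumes "finite (carrier G)"
  obtains S where "finite S" "card S = gen_number G" "generating_set G S"
proof -
  have "generating_set G (carrier G)"
    using generate_incl[of "carrier G"] by (auto simp: generating_set_def intro: generate.incl)
  then have "\<exists>k S. finite S \<and> card S = k \<and> generating_set G S" using assms by blast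
  from LeastI_ex[OF this] show thesis using that unfolding gen_number_def by blast
qed

section \<open>Complements of an abelian minimal normal subgroup\<close>

locale abelian_minimal_normal = normal N G for N and G (structure) +
  assumes fin: "finite (carrier G)"
    and minimal: "minimal_normal_subgroup N G"
    and comm: "\<lbrakk>a \<in> N; b \<in> N\<rbrakk> \<Longrightarrow> a \<otimes> b = b \<otimes> a"
begin

lemma nontrivial: "N \<noteq> {\<one>}"
  using minimal by (simp add: minimal_normal_subgroup_def)

text \<open>\<open>L \<inter> N\<close> is normalised by \<open>L\<close>, as \<open>N\<close> is
  normal, and centralised by \<open>N\<close>, as \<open>N\<close> is abelian; so it is normal in
  \<open>L <#> N\<close>, the whole group. Minimality leaves \<open>{\<one>}\<close> and
  \<open>N\<close>, and in the latter case \<open>N\<close> lies in \<open>L\<close>, which makes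
  \<open>L\<close> everything.\<close>

lemma supplement_dichotomy:
  assumes L: "subgroup L G" and LN: "L <#> N = carrier G"
  shows "L = carrier G \<or> L \<inter> N = {\<one>}"
proof -
  have Lc: "L \<subseteq> carrier G" using subgroup.subset[OF L] .
  have "L \<inter> N \<lhd> G"
  proof (rule normal_invI)
    show "subgroup (L \<inter> N) G" using L subgroup_axioms by (rule subgroups_Inter_pair)
    fix x m assume x: "x \<in> carrier G" and m: "m \<in> L \<inter> N"
    obtain l n where l: "l \<in> L" and n: "n \<in> N" and xln: "x = l \<otimes> n"
      using x unfolding LN[symmetric] set_mult_def by blast
    have lc: "l \<in> carrier G" and mc: "m \<in> carrier G" and nc: "n \<in> carrier G"
      using l n m Lc by auto
    have "x \<otimes> m \<otimes> inv x = l \<otimes> (n \<otimes> m) \<otimes> inv n \<otimes> inv l"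
      using lc mc nc by (simp add: xln inv_mult_group m_assoc)
    also have "n \<otimes> m = m \<otimes> n" using m n comm by blast
    also have "l \<otimes> (m \<otimes> n) \<otimes> inv n \<otimes> inv l = l \<otimes> m \<otimes> inv l"
      using lc mc nc by (simp add: m_assoc inv_solve_right')
    finally have e: "x \<otimes> m \<otimes> inv x = l \<otimes> m \<otimes> inv l" .
    have "l \<otimes> m \<otimes> inv l \<in> L"
      using l m L by (simp add: subgroup.m_closed subgroup.m_inv_closed)
    moreover have "x \<otimes> m \<otimes> inv x \<in> N" using inv_op_closed2 x m by blast
    ultimately show "x \<otimes> m \<otimes> inv x \<in> L \<inter> N" using e by simp
  qed
  then consider "L \<inter> N = {\<one>}" | "L \<inter> N = N"
    using minimal unfolding minimal_normal_subgroup_def by blast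
  then show ?thesis
  proof cases
    case 2
    then have "L <#> N \<subseteq> L" using subgroup.m_closed[OF L] by (auto simp: set_mult_def)
    then show ?thesis using LN Lc by blast
  qed simp
qed

text \<open>If \<open>H\<close> is a complement of \<open>N\<close>, the complements of \<open>N\<close> are the graphs
  \<open>{h \<otimes> \<delta> h | h \<in> H}\<close> of the crossed homomorphisms \<open>\<delta>\<close> from \<open>H\<close> to \<open>N\<close>. The subgroup constructed
  below is the graph of the pointwise product of two of them.\<close>

lemma complement_product:
  assumes H: "subgroup H G" "H \<inter> N = {\<one>}"
    and K: "subgroup K G" "K \<inter> N = {\<one>}"
    and L: "subgroup L G" "L \<inter> N = {\<one>}"
  obtains P where "subgroup P G" "P \<inter> N = {\<one>}"
    "\<forall>h\<in>H. \<forall>a\<in>N. \<forall>b\<in>N. h \<otimes> a \<in> K \<longrightarrow> h \<otimes> b \<in> L \<longrightarrow> h \<otimes> (a \<otimes> b) \<in> P"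
proof
  define P where "P = {h \<otimes> (a \<otimes> b) | h a b. h \<in> H \<and> a \<in> N \<and> b \<in> N \<and> h \<otimes> a \<in> K \<and> h \<otimes> b \<in> L}"
  have Hc: "H \<subseteq> carrier G" using subgroup.subset[OF H(1)] .
  have PI: "h \<otimes> (a \<otimes> b) \<in> P"
    if "h \<in> H" "a \<in> N" "b \<in> N" "h \<otimes> a \<in> K" "h \<otimes> b \<in> L" for h a b
    using that unfolding P_def by blast
  then show "\<forall>h\<in>H. \<forall>a\<in>N. \<forall>b\<in>N. h \<otimes> a \<in> K \<longrightarrow> h \<otimes> b \<in> L \<longrightarrow> h \<otimes> (a \<otimes> b) \<in> P" by blast
  show "subgroup P G"
  proof
    show "P \<subseteq> carrier G" using Hc unfolding P_def by auto
    have "\<one> \<otimes> (\<one> \<otimes> \<one>) \<in> P"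
      using H K L by (intro PI) (auto intro: subgroup.one_closed)
    then show "\<one> \<in> P" by simp
  next
    fix x y assume "x \<in> P" "y \<in> P"
    then obtain h a b k c d where
      h: "h \<in> H" "a \<in> N" "b \<in> N" "h \<otimes> a \<in> K" "h \<otimes> b \<in> L" "x = h \<otimes> (a \<otimes> b)" and
      k: "k \<in> H" "c \<in> N" "d \<in> N" "k \<otimes> c \<in> K" "k \<otimes> d \<in> L" "y = k \<otimes> (c \<otimes> d)"
      unfolding P_def by blast
    have cl: "h \<in> carrier G" "k \<in> carrier G" "a \<in> carrier G" "b \<in> carrier G"
      "c \<in> carrier G" "d \<in> carrier G" using h k Hc by auto
    \<comment> \<open>Moving \<open>k\<close> to the left past \<open>a\<close> and \<open>b\<close>
      conjugates them: \<open>a' \<otimes> c\<close> and \<open>b' \<otimes> d\<close> are the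
      values at \<open>h \<otimes> k\<close> given by the crossed homomorphism rule.\<close>
    define a' b' where "a' = inv k \<otimes> a \<otimes> k" and "b' = inv k \<otimes> b \<otimes> k"
    have N': "a' \<in> N" "b' \<in> N" using inv_op_closed1 cl h by (auto simp: a'_def b'_def)
    have cl': "a' \<in> carrier G" "b' \<in> carrier G" using N' by auto
    have ka: "k \<otimes> (a' \<otimes> z) = a \<otimes> (k \<otimes> z)" "k \<otimes> (b' \<otimes> z) = b \<otimes> (k \<otimes> z)"
      if "z \<in> carrier G" for z
      using that cl by (simp_all add: a'_def b'_def m_assoc[symmetric])
    have "(h \<otimes> k) \<otimes> (a' \<otimes> c) = (h \<otimes> a) \<otimes> (k \<otimes> c)" "(h \<otimes> k) \<otimes> (b' \<otimes> d) = (h \<otimes> b) \<otimes> (k \<otimes> d)"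
      using cl cl' ka by (simp_all add: m_assoc)
    then have "(h \<otimes> k) \<otimes> (a' \<otimes> c) \<in> K" "(h \<otimes> k) \<otimes> (b' \<otimes> d) \<in> L"
      using h k K(1) L(1) by (simp_all add: subgroup.m_closed)
    then have "(h \<otimes> k) \<otimes> ((a' \<otimes> c) \<otimes> (b' \<otimes> d)) \<in> P"
      using h k N' H(1) by (intro PI) (simp_all add: subgroup.m_closed)
    moreover have "(h \<otimes> k) \<otimes> ((a' \<otimes> c) \<otimes> (b' \<otimes> d)) = x \<otimes> y"
    proof -
      have "(a' \<otimes> c) \<otimes> (b' \<otimes> d) = a' \<otimes> (c \<otimes> b') \<otimes> d" using cl cl' by (simp add: m_assoc)
      \<comment> \<open>Commutativity of \<open>N\<close> is what makes the pointwise product of the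
        two crossed homomorphisms multiplicative again.\<close>
      also have "c \<otimes> b' = b' \<otimes> c" using k N' comm by blast
      finally have "(h \<otimes> k) \<otimes> ((a' \<otimes> c) \<otimes> (b' \<otimes> d)) = h \<otimes> (k \<otimes> (a' \<otimes> (b' \<otimes> (c \<otimes> d))))"
        using cl cl' by (simp add: m_assoc)
      then show ?thesis using cl cl' h(6) k(6) ka by (simp add: m_assoc)
    qed
    ultimately show "x \<otimes> y \<in> P" by simp
  next
    fix x assume "x \<in> P"
    then obtain h a b where
      h: "h \<in> H" "a \<in> N" "b \<in> N" "h \<otimes> a \<in> K" "h \<otimes> b \<in> L" "x = h \<otimes> (a \<otimes> b)"
      unfolding P_def by blast
    have cl: "h \<in> carrier G" "a \<in> carrier G" "b \<in> carrier G" using h Hc by auto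
    \<comment> \<open>The values at \<open>inv h\<close>, chosen so that
      \<open>inv h \<otimes> a'\<close> is the inverse of \<open>h \<otimes> a\<close>, and likewise
      for \<open>b\<close>.\<close>
    define a' b' where "a' = h \<otimes> inv a \<otimes> inv h" and "b' = h \<otimes> inv b \<otimes> inv h"
    have N': "a' \<in> N" "b' \<in> N" using inv_op_closed2 cl h by (auto simp: a'_def b'_def)
    have "inv h \<otimes> a' = inv (h \<otimes> a)" "inv h \<otimes> b' = inv (h \<otimes> b)"
      using cl by (simp_all add: a'_def b'_def inv_mult_group m_assoc[symmetric])
    then have "inv h \<otimes> a' \<in> K" "inv h \<otimes> b' \<in> L"
      using h K(1) L(1) by (simp_all add: subgroup.m_inv_closed)
    then have "inv h \<otimes> (a' \<otimes> b') \<in> P"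
      using h N' H(1) by (intro PI) (simp_all add: subgroup.m_inv_closed)
    moreover have "inv h \<otimes> (a' \<otimes> b') = inv x"
    proof -
      have "inv (a \<otimes> b) = inv a \<otimes> inv b"
        using comm[OF h(2,3)] cl by (simp add: inv_mult_group)
      then have "inv x = inv a \<otimes> inv b \<otimes> inv h" using cl h(6) by (simp add: inv_mult_group)
      moreover have "inv h \<otimes> (a' \<otimes> b') = inv a \<otimes> inv b \<otimes> inv h"
      proof -
        have "inv h \<otimes> (h \<otimes> z) = z" if "z \<in> carrier G" for z
          using that cl by (simp add: m_assoc[symmetric])
        then show ?thesis using cl by (simp add: a'_def b'_def m_assoc)
      qed
      ultimately show ?thesis by simp
    qed
    ultimately show "inv x \<in> P" by simp
  qed
  then have "\<one> \<in> P" by (rule subgroup.one_closed)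
  moreover have "x = \<one>" if "x \<in> P" "x \<in> N" for x
  proof -
    from that obtain h a b where
      h: "h \<in> H" "a \<in> N" "b \<in> N" "h \<otimes> a \<in> K" "h \<otimes> b \<in> L" "x = h \<otimes> (a \<otimes> b)"
      unfolding P_def by blast
    have hc: "h \<in> carrier G" using h Hc by auto
    \<comment> \<open>If \<open>x\<close> lies in \<open>N\<close>, so does its part
      \<open>h\<close> in \<open>H\<close>; hence \<open>h = \<one>\<close>, which puts
      \<open>a\<close> into \<open>K \<inter> N\<close> and \<open>b\<close> into
      \<open>L \<inter> N\<close>.\<close>
    have "h = x \<otimes> inv (a \<otimes> b)" unfolding h(6) using hc h(2,3) by (simp add: m_assoc)
    then have "h \<in> N"
      using that(2) h(2,3) by (metis subgroup.m_closed[OF subgroup_axioms] m_inv_closed)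
    then have "h = \<one>" using H h by blast
    then have "a \<in> K" "b \<in> L" using h by auto
    then have "a = \<one>" "b = \<one>" using K L h by auto
    then show ?thesis using h \<open>h = \<one>\<close> by simp
  qed
  ultimately show "P \<inter> N = {\<one>}" using subgroup.one_closed[OF subgroup_axioms] by blast
qed

section \<open>Lifts of a generating tuple that fail to generate\<close>

text \<open>Undoing the factors \<open>f i\<close> modulo \<open>N\<close> shows that any lift still
  generates a supplement of \<open>N\<close>. By the dichotomy, a supplement other than
  \<open>G\<close> meets \<open>N\<close> trivially.\<close>

lemma nongenerating_lift:
  assumes g: "g \<in> I \<rightarrow> carrier G" and gen: "generate G (g ` I \<union> N) = carrier G"
    and f: "f \<in> I \<rightarrow> N"
    and fail: "generate G ((\<lambda>i. g i \<otimes> f i) ` I) \<noteq> carrier G"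
  obtains K where "subgroup K G" "K \<inter> N = {\<one>}" "\<And>i. i \<in> I \<Longrightarrow> g i \<otimes> f i \<in> K"
proof
  let ?K = "generate G ((\<lambda>i. g i \<otimes> f i) ` I)"
  have gc: "g i \<in> carrier G" and fN: "f i \<in> N" if "i \<in> I" for i using that g f by auto
  have "(\<lambda>i. g i \<otimes> f i) ` I \<subseteq> carrier G" using gc fN by auto
  then show sub: "subgroup ?K G" by (rule generate_is_subgroup)
  show mem: "g i \<otimes> f i \<in> ?K" if "i \<in> I" for i using that by (auto intro: generate.incl)
  have "g i \<in> ?K <#> N" if i: "i \<in> I" for i
  proof -
    have "g i \<otimes> f i \<otimes> inv (f i) \<in> ?K <#> N"
      using mem[OF i] fN[OF i] unfolding set_mult_def by blast
    then show ?thesis using gc[OF i] fN[OF i] by (simp add: m_assoc)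
  qed
  then have "?K <#> N = carrier G" using gen by (intro set_mult_eq_carrier[OF sub]) auto
  with supplement_dichotomy[OF sub] fail show "?K \<inter> N = {\<one>}" by blast
qed

text \<open>Switch on the entries of \<open>f\<close> one at a time: the induction is on the set
  \<open>J\<close> of entries already modified, and each step multiplies in the crossed homomorphism
  of a single-entry modification. Thus the failures of \<open>g\<close> and of its single-entry
  modifications control all lifts.\<close>

lemma all_lifts_in_complements:
  assumes I: "finite I"
    and g: "g \<in> I \<rightarrow> carrier G" and gen: "generate G (g ` I \<union> N) = carrier G"
    and fail: "generate G (g ` I) \<noteq> carrier G"
    and fail1: "\<And>i n. \<lbrakk>i \<in> I; n \<in> N\<rbrakk> \<Longrightarrow> generate G ((g(i := g i \<otimes> n)) ` I) \<noteq> carrier G"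
    and f: "f \<in> I \<rightarrow> N"
  shows "\<exists>K. subgroup K G \<and> K \<inter> N = {\<one>} \<and> (\<forall>i\<in>I. g i \<otimes> f i \<in> K)"
proof -
  have g1: "g i \<otimes> \<one> = g i" if "i \<in> I" for i using Pi_mem[OF g that] by simp
  have im: "(\<lambda>i. g i \<otimes> \<one>) ` I = g ` I" using g1 by simp
  \<comment> \<open>The unmodified tuple supplies the complement \<open>H\<close> that serves as the
    origin for the products.\<close>
  obtain H where H: "subgroup H G" "H \<inter> N = {\<one>}" "\<And>i. i \<in> I \<Longrightarrow> g i \<in> H"
  proof (rule nongenerating_lift[OF g gen, of "\<lambda>_. \<one>"])
    show "generate G ((\<lambda>i. g i \<otimes> \<one>) ` I) \<noteq> carrier G" using fail unfolding im .
  qed (use g1 in auto)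
  have "\<exists>K. subgroup K G \<and> K \<inter> N = {\<one>} \<and> (\<forall>i\<in>I. g i \<otimes> (if i \<in> J then f i else \<one>) \<in> K)"
    if "finite J" "J \<subseteq> I" for J
    using that
  proof (induction J)
    case empty
    then show ?case using H g1 by auto
  next
    case (insert j J)
    then obtain K where K: "subgroup K G" "K \<inter> N = {\<one>}"
      "\<And>i. i \<in> I \<Longrightarrow> g i \<otimes> (if i \<in> J then f i else \<one>) \<in> K" by auto
    have j: "j \<in> I" "f j \<in> N" using insert.prems f by auto
    have im_j: "(\<lambda>i. g i \<otimes> (if i = j then f j else \<one>)) ` I = (g(j := g j \<otimes> f j)) ` I"
      using g1 by (intro image_cong) auto
    obtain L where L: "subgroup L G" "L \<inter> N = {\<one>}"
      "\<And>i. i \<in> I \<Longrightarrow> g i \<otimes> (if i = j then f j else \<one>) \<in> L"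
    proof (rule nongenerating_lift[OF g gen, of "\<lambda>i. if i = j then f j else \<one>"])
      show "generate G ((\<lambda>i. g i \<otimes> (if i = j then f j else \<one>)) ` I) \<noteq> carrier G"
        using fail1[OF j] unfolding im_j .
    qed (use j in auto)
    obtain P where P: "subgroup P G" "P \<inter> N = {\<one>}"
      "\<forall>h\<in>H. \<forall>a\<in>N. \<forall>b\<in>N. h \<otimes> a \<in> K \<longrightarrow> h \<otimes> b \<in> L \<longrightarrow> h \<otimes> (a \<otimes> b) \<in> P"
      by (rule complement_product[OF H(1,2) K(1,2) L(1,2)]) (rule that)
    have "g i \<otimes> (if i \<in> insert j J then f i else \<one>) \<in> P" if i: "i \<in> I" for i
    proof -
      have fi: "f i \<in> N" using f i by auto
      \<comment> \<open>Since \<open>j\<close> is not in \<open>J\<close>, at most one of the two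
        factors differs from \<open>\<one>\<close> at any \<open>i\<close>, so their product is the
        modification for \<open>insert j J\<close>.\<close>
      have "g i \<otimes> ((if i \<in> J then f i else \<one>) \<otimes> (if i = j then f j else \<one>)) \<in> P"
        using H(3)[OF i] K(3)[OF i] L(3)[OF i] fi j by (intro P(3)[rule_format]) auto
      then show ?thesis using fi insert.hyps by (auto split: if_splits)
    qed
    then show ?case using P(1,2) by blast
  qed
  from this[OF I] show ?thesis by auto
qed

text \<open>Gaschuetz's counting argument. A complement contains exactly one lift of any generating tuple
  of the quotient, and that lift generates it; so the number of lifts that fail to generate is the
  number of complements, whichever generating tuple is lifted.\<close>

lemma no_generating_family:
  assumes I: "finite I" and g: "g \<in> I \<rightarrow> carrier G"
    and compl: "\<And>f. f \<in> I \<rightarrow> N \<Longrightarrow>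
      \<exists>K. subgroup K G \<and> K \<inter> N = {\<one>} \<and> (\<forall>i\<in>I. g i \<otimes> f i \<in> K)"
    and gen: "generate G (g ` I \<union> N) = carrier G"
    and x: "x \<in> I \<rightarrow> carrier G"
  shows "generate G (x ` I) \<noteq> carrier G"
proof
  assume xgen: "generate G (x ` I) = carrier G"
  \<comment> \<open>Extensional functions, so that \<open>A\<close> is finite and its members are
    determined by their values on \<open>I\<close>.\<close>
  define A where "A = I \<rightarrow>\<^sub>E N"
  have gc: "g i \<in> carrier G" and xc: "x i \<in> carrier G" if "i \<in> I" for i using that g x by auto
  have AN: "f i \<in> N" if "f \<in> A" "i \<in> I" for f i using that by (auto simp: A_def)
  have "finite A" using I finite_subset[OF subset fin] by (simp add: A_def finite_PiE)
  have "\<exists>K. subgroup K G \<and> K \<inter> N = {\<one>} \<and> (\<forall>i\<in>I. g i \<otimes> f i \<in> K)" if "f \<in> A" for f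
    using that by (intro compl) (auto simp: A_def)
  then obtain K where K: "\<And>f. f \<in> A \<Longrightarrow> subgroup (K f) G"
    "\<And>f. f \<in> A \<Longrightarrow> K f \<inter> N = {\<one>}" "\<And>f i. \<lbrakk>f \<in> A; i \<in> I\<rbrakk> \<Longrightarrow> g i \<otimes> f i \<in> K f"
    by metis
  have KN: "K f <#> N = carrier G" if f: "f \<in> A" for f
  proof (rule set_mult_eq_carrier[OF K(1)[OF f] _ gen], rule image_subsetI)
    fix i assume i: "i \<in> I"
    have "g i \<otimes> f i \<otimes> inv (f i) \<in> K f <#> N"
      using K(3)[OF f i] AN[OF f i] unfolding set_mult_def by blast
    then show "g i \<in> K f <#> N" using gc[OF i] AN[OF f i] by (simp add: m_assoc)
  qed
  \<comment> \<open>As \<open>K f\<close> supplements \<open>N\<close>, each \<open>x i\<close> can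
    be corrected by an element of \<open>N\<close> so as to land in \<open>K f\<close>.\<close>
  have "\<exists>n. n \<in> N \<and> x i \<otimes> n \<in> K f" if f: "f \<in> A" and i: "i \<in> I" for f i
  proof -
    obtain k n where k: "k \<in> K f" "n \<in> N" "x i = k \<otimes> n"
      using xc[OF i] unfolding KN[OF f, symmetric] set_mult_def by blast
    moreover have "k \<in> carrier G" using k subgroup.subset[OF K(1)[OF f]] by blast
    ultimately have "x i \<otimes> inv n = k" by (simp add: m_assoc)
    then show ?thesis using k by auto
  qed
  then obtain e where e: "\<And>f i. \<lbrakk>f \<in> A; i \<in> I\<rbrakk> \<Longrightarrow> e f i \<in> N"
    "\<And>f i. \<lbrakk>f \<in> A; i \<in> I\<rbrakk> \<Longrightarrow> x i \<otimes> e f i \<in> K f" by metis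
  \<comment> \<open>Sends the modification of \<open>g\<close> lying in \<open>K f\<close> to a
    modification of \<open>x\<close> lying in the same complement.\<close>
  define \<Phi> where "\<Phi> f = restrict (e f) I" for f
  \<comment> \<open>The corrected \<open>x\<close> generates a supplement \<open>?L\<close> inside
    \<open>K f\<close>. Writing \<open>k = l \<otimes> n\<close> with \<open>l\<close> in
    \<open>?L\<close> puts \<open>n\<close> into \<open>K f \<inter> N\<close>, so the two subgroups
    coincide and \<open>\<Phi> f\<close> determines \<open>K f\<close>.\<close>
  have K_gen: "K f = generate G ((\<lambda>i. x i \<otimes> e f i) ` I)" if f: "f \<in> A" for f
  proof
    let ?L = "generate G ((\<lambda>i. x i \<otimes> e f i) ` I)"
    have "(\<lambda>i. x i \<otimes> e f i) ` I \<subseteq> carrier G" using xc e(1)[OF f] by auto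
    then have sub: "subgroup ?L G" by (rule generate_is_subgroup)
    show LK: "?L \<subseteq> K f" using e(2)[OF f] by (intro generate_subgroup_incl K(1) f) auto
    have "x i \<in> ?L <#> N" if i: "i \<in> I" for i
    proof -
      have "x i \<otimes> e f i \<otimes> inv (e f i) \<in> ?L <#> N"
        using e(1)[OF f i] i unfolding set_mult_def by (blast intro: generate.incl m_inv_closed)
      then show ?thesis using xc[OF i] e(1)[OF f i] by (simp add: m_assoc)
    qed
    moreover have "generate G (x ` I \<union> N) = carrier G"
      using xgen mono_generate[of "x ` I" "x ` I \<union> N"] generate_incl[of "x ` I \<union> N"] xc subset
      by blast
    ultimately have LN: "?L <#> N = carrier G" by (intro set_mult_eq_carrier[OF sub]) auto
    show "K f \<subseteq> ?L"
    proof
      fix k assume k: "k \<in> K f"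
      then have kc: "k \<in> carrier G" using subgroup.subset[OF K(1)[OF f]] by blast
      then obtain l n where l: "l \<in> ?L" "n \<in> N" "k = l \<otimes> n"
        unfolding LN[symmetric] set_mult_def by blast
      have lc: "l \<in> carrier G" using l subgroup.subset[OF sub] by blast
      have "n = inv l \<otimes> k" using l lc by (simp add: m_assoc[symmetric])
      then have "n \<in> K f"
        using k l(1) LK K(1)[OF f] by (auto intro: subgroup.m_closed subgroup.m_inv_closed)
      then have "n = \<one>" using K(2)[OF f] l by blast
      then show "k \<in> ?L" using l lc by simp
    qed
  qed
  have "inj_on \<Phi> A"
  proof (rule inj_onI)
    fix f f' assume f: "f \<in> A" and f': "f' \<in> A" and eq: "\<Phi> f = \<Phi> f'"
    have "e f i = e f' i" if "i \<in> I" for i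
      using fun_cong[OF eq, of i] that by (simp add: \<Phi>_def)
    then have KK: "K f = K f'" unfolding K_gen[OF f] K_gen[OF f'] by (simp cong: image_cong)
    have "f i = f' i" if i: "i \<in> I" for i
    proof -
      have cl: "f i \<in> carrier G" "f' i \<in> carrier G" using AN[OF f i] AN[OF f' i] by auto
      \<comment> \<open>Two lifts of \<open>g i\<close> in the same complement differ by an element
        of its trivial intersection with \<open>N\<close>.\<close>
      have "inv (g i \<otimes> f i) \<otimes> (g i \<otimes> f' i) \<in> K f"
        using K(3)[OF f i] K(3)[OF f' i] K(1)[OF f] KK
        by (auto intro: subgroup.m_closed subgroup.m_inv_closed)
      moreover have "inv (g i \<otimes> f i) \<otimes> (g i \<otimes> f' i) = inv (f i) \<otimes> f' i"
      proof -
        have "inv (g i) \<otimes> (g i \<otimes> f' i) = f' i" using cl gc[OF i] by (simp add: m_assoc[symmetric])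
        then show ?thesis using cl gc[OF i] by (simp add: inv_mult_group m_assoc)
      qed
      ultimately have "inv (f i) \<otimes> f' i \<in> K f \<inter> N" using AN[OF f i] AN[OF f' i] by simp
      then have "inv (f i) \<otimes> f' i = \<one>" using K(2)[OF f] by blast
      then show ?thesis using cl by (metis inv_equality inv_inv inv_closed)
    qed
    then show "f = f'" using f f' by (auto simp: A_def intro: PiE_ext)
  qed
  moreover have "\<Phi> ` A \<subseteq> A" using e(1) by (auto simp: \<Phi>_def A_def)
  \<comment> \<open>An injective self-map of a finite set is onto, so the trivial modification of
    \<open>x\<close> is attained: \<open>x\<close> itself lies in some \<open>K f\<close>, which
    then contains \<open>N\<close>.\<close>
  ultimately have "\<Phi> ` A = A" using \<open>finite A\<close> by (simp add: endo_inj_surj)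
  moreover have "(\<lambda>i\<in>I. \<one>) \<in> A" by (auto simp: A_def)
  ultimately obtain f where f: "f \<in> A" "\<Phi> f = (\<lambda>i\<in>I. \<one>)" by (metis imageE)
  have "x i \<in> K f" if i: "i \<in> I" for i
  proof -
    have "e f i = \<one>" using fun_cong[OF f(2), of i] i by (simp add: \<Phi>_def)
    then show ?thesis using e(2)[OF f(1) i] xc[OF i] by simp
  qed
  then have "generate G (x ` I) \<subseteq> K f" by (intro generate_subgroup_incl K(1) f) auto
  then have "N \<subseteq> K f" using xgen subset by blast
  then show False using K(2)[OF f(1)] nontrivial by blast
qed

section \<open>Minimality of the answers\<close>

text \<open>Supplies the lower bound \<open>d \<le> gen_number G\<close>, so that a generating tuple
  of length \<open>d\<close> found by a test is automatically minimum.\<close>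

lemma gen_number_Mod_le: "gen_number (G Mod N) \<le> gen_number G"
proof -
  obtain S where S: "finite S" "card S = gen_number G" "generating_set G S"
    using gen_number_attained[OF fin] .
  then have Sc: "S \<subseteq> carrier G" and "generate G S = carrier G" by (auto simp: generating_set_def)
  then have "generate G (S \<union> N) = carrier G"
    using mono_generate[of S "S \<union> N"] generate_incl[of "S \<union> N"] subset by blast
  then have "generating_set (G Mod N) ((\<lambda>g. g <# N) ` S)" by (simp add: generate_Mod_iff[OF Sc])
  then have "gen_number (G Mod N) \<le> card ((\<lambda>g. g <# N) ` S)"
    using S(1) by (intro group.gen_number_le factorgroup_is_group) auto
  also have "\<dots> \<le> card S" using S(1) by (rule card_image_le)
  finally show ?thesis using S(2) by simp
qed

text \<open>Repeated entries do no harm: \<open>card (set xs)\<close> is at most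
  \<open>length xs\<close>, and no generating set is smaller than
  \<open>gen_number G\<close>.\<close>

lemma minimum_of_tuple:
  assumes "generating_set G (set xs)" "length xs \<le> gen_number G"
  shows "minimum_generating_set G (set xs)"
  using assms gen_number_le[of "set xs"] card_length[of xs]
  by (simp add: minimum_generating_set_def)

text \<open>When every test fails, all lifts lie in complements, so no \<open>d\<close> elements
  generate and \<open>d + 1\<close> are necessary. They suffice: adjoining \<open>v\<close> gives a
  supplement meeting \<open>N\<close> nontrivially, which is \<open>G\<close> by the
  dichotomy.\<close>

lemma minimum_of_extra_element:
  assumes gs: "gs \<in> tuples G d" and gen: "generate G (set gs \<union> N) = carrier G"
    and d: "d \<le> gen_number G"
    and fail: "\<not> generating_set G (set gs)"
    and fail1: "\<And>i n. \<lbrakk>i < d; n \<in> N\<rbrakk> \<Longrightarrow> \<not> generating_set G (set (gs[i := gs ! i \<otimes> n]))"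
    and v: "v \<in> N" "v \<noteq> \<one>"
  shows "minimum_generating_set G (set (gs @ [v]))"
proof (rule minimum_of_tuple)
  have len: "length gs = d" and gsc: "set gs \<subseteq> carrier G" using gs by (auto simp: tuples_def)
  \<comment> \<open>Passes from lists to families indexed by \<open>{..<d}\<close>, the form used by
    the lemmas on lifts.\<close>
  have im: "(!) ys ` {..<d} = set ys" if "length ys = d" for ys :: "'a list"
    using that by (auto simp: set_conv_nth)
  have g: "(!) gs \<in> {..<d} \<rightarrow> carrier G" using gsc len by auto
  have gen': "generate G ((!) gs ` {..<d} \<union> N) = carrier G" using gen im len by simp
  have compl: "\<exists>K. subgroup K G \<and> K \<inter> N = {\<one>} \<and> (\<forall>i\<in>{..<d}. gs ! i \<otimes> f i \<in> K)"
    if f: "f \<in> {..<d} \<rightarrow> N" for f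
  proof (rule all_lifts_in_complements[OF _ g gen' _ _ f])
    show "generate G ((!) gs ` {..<d}) \<noteq> carrier G"
      using fail gsc im len by (simp add: generating_set_def)
    fix i n assume i: "i \<in> {..<d}" and n: "n \<in> N"
    have "((!) gs)(i := gs ! i \<otimes> n) ` {..<d} = (!) (gs[i := gs ! i \<otimes> n]) ` {..<d}"
      using len i by (intro image_cong) (auto simp: nth_list_update)
    then have "((!) gs)(i := gs ! i \<otimes> n) ` {..<d} = set (gs[i := gs ! i \<otimes> n])"
      using im len by simp
    moreover have "set (gs[i := gs ! i \<otimes> n]) \<subseteq> carrier G"
    proof -
      have "gs ! i \<otimes> n \<in> carrier G" using g i n by auto
      then show ?thesis using gsc set_update_subset_insert[of gs i "gs ! i \<otimes> n"] by blast
    qed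
    ultimately show "generate G (((!) gs)(i := gs ! i \<otimes> n) ` {..<d}) \<noteq> carrier G"
      using fail1[of i n] i n by (simp add: generating_set_def)
  qed simp
  have "gen_number G \<noteq> d"
  proof
    assume eq: "gen_number G = d"
    obtain S where S: "finite S" "card S = d" "generating_set G S"
      using gen_number_attained[OF fin] eq by metis
    obtain xs where xs: "set xs = S" "length xs = d"
      using finite_distinct_list[OF S(1)] S(2) distinct_card by fastforce
    have "(!) xs \<in> {..<d} \<rightarrow> carrier G" using xs S(3) by (auto simp: generating_set_def)
    from no_generating_family[OF _ g compl gen' this]
    show False using S(3) xs im[of xs] by (simp add: generating_set_def)
  qed
  then show "length (gs @ [v]) \<le> gen_number G" using d len by simp
  let ?L = "generate G (set (gs @ [v]))"
  have sc: "set (gs @ [v]) \<subseteq> carrier G" using gsc v by auto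
  then have sub: "subgroup ?L G" by (rule generate_is_subgroup)
  have "set gs \<subseteq> ?L <#> N"
  proof
    fix s assume "s \<in> set gs"
    then have s: "s \<in> ?L" "s \<in> carrier G" using gsc by (auto intro: generate.incl)
    then have "s \<otimes> \<one> \<in> ?L <#> N"
      using subgroup.one_closed[OF subgroup_axioms] unfolding set_mult_def by blast
    then show "s \<in> ?L <#> N" using s by simp
  qed
  then have "?L <#> N = carrier G" by (rule set_mult_eq_carrier[OF sub _ gen])
  moreover have "v \<in> ?L" by (simp add: generate.incl)
  ultimately have "?L = carrier G" using supplement_dichotomy[OF sub] v by blast
  then show "generating_set G (set (gs @ [v]))" using sc by (simp add: generating_set_def)
qed

end

section \<open>The testing procedure in group terms\<close>

primrec first_generating :: "'v group_term list list \<Rightarrow> 'v group_term list \<Rightarrow> 'v procedure" where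
  "first_generating [] us = Return us"
| "first_generating (ts # tss) us = Test ts (Return ts) (first_generating tss us)"

lemma set_first_generating:
  "set_procedure (first_generating tss us) = (\<Union>ts\<in>set (tss @ [us]). \<Union>t\<in>set ts. set_group_term t)"
  by (induction tss) auto

lemma length_tested_first_generating:
  "length (tested G \<rho> (first_generating tss us)) \<le> length tss"
  by (induction tss) auto

lemma set_tested_first_generating:
  "set (tested G \<rho> (first_generating tss us)) \<subseteq> map (eval_term G \<rho>) ` set tss"
  by (induction tss) auto

lemma result_first_generating:
  obtains ts where "ts \<in> set tss" "generating_set G (set (map (eval_term G \<rho>) ts))"
      "result G \<rho> (first_generating tss us) = map (eval_term G \<rho>) ts"
  | "\<And>ts. ts \<in> set tss \<Longrightarrow> \<not> generating_set G (set (map (eval_term G \<rho>) ts))"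
      "result G \<rho> (first_generating tss us) = map (eval_term G \<rho>) us"
proof -
  have "(\<exists>ts\<in>set tss. generating_set G (set (map (eval_term G \<rho>) ts)) \<and>
      result G \<rho> (first_generating tss us) = map (eval_term G \<rho>) ts) \<or>
    (\<forall>ts\<in>set tss. \<not> generating_set G (set (map (eval_term G \<rho>) ts))) \<and>
      result G \<rho> (first_generating tss us) = map (eval_term G \<rho>) us"
    by (induction tss) auto
  then show thesis using that by blast
qed

text \<open>The position of the identity in the list of elements of \<open>N\<close> is unknown, so the nontrivial
  elements are addressed as quotients of the first entry with the others.\<close>

definition quotient_term :: "nat \<Rightarrow> nat \<Rightarrow> nat group_term" where
  "quotient_term d j = Mult (Inv (Var d)) (Var (d + j))"

text \<open>The index \<open>j\<close> starts at 1 because \<open>j = 0\<close> denotes the identity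
  and would repeat the unmodified tuple; this gives \<open>m - 1\<close> tests per entry, plus
  one.\<close>

definition candidates :: "nat \<Rightarrow> nat \<Rightarrow> nat group_term list list" where
  "candidates d m = map Var [0..<d] #
     concat (map (\<lambda>i. map (\<lambda>j. (map Var [0..<d])[i := Mult (Var i) (quotient_term d j)]) [1..<m]) [0..<d])"

text \<open>The answer after total failure appends \<open>quotient_term d 1\<close>, a quotient of
  two distinct elements of \<open>N\<close> and hence nontrivial.\<close>

definition lifting_procedure :: "nat \<Rightarrow> nat \<Rightarrow> nat procedure" where
  "lifting_procedure d m =
     first_generating (candidates d m) (map Var [0..<d] @ [quotient_term d 1])"

lemma set_candidates:
  "set (candidates d m) = insert (map Var [0..<d])
     ((\<lambda>(i, j). (map Var [0..<d])[i := Mult (Var i) (quotient_term d j)]) ` ({..<d} \<times> {1..<m}))"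
  by (auto simp: candidates_def)

lemma length_candidates: "length (candidates d m) = d * (m - 1) + 1"
  by (simp add: candidates_def length_concat comp_def sum_list_triv)

text \<open>The appended term mentions \<open>Var (d + 1)\<close>, which is in range because
  \<open>m\<close> is at least 2.\<close>

lemma set_lifting_procedure:
  assumes "2 \<le> m"
  shows "set_procedure (lifting_procedure d m) \<subseteq> {..<d + m}"
proof -
  have "set_group_term t \<subseteq> {..<d + m}" if "ts \<in> set (candidates d m)" "t \<in> set ts" for t ts
    using that assms set_update_subset_insert[of "map Var [0..<d]"]
    by (fastforce simp: set_candidates quotient_term_def)
  then show ?thesis
    using assms by (auto simp: lifting_procedure_def set_first_generating quotient_term_def)
qed

theorem corollary10:
  shows "\<exists>find :: nat \<Rightarrow> nat \<Rightarrow> nat procedure.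
    \<forall>(G :: ('a, 'b) monoid_scheme) N gs ns d.
      group G \<and> finite (carrier G) \<and>
      minimal_normal_subgroup N G \<and> comm_group (G\<lparr>carrier := N\<rparr>) \<and>
      gs \<in> tuples G d \<and>
      distinct (map (\<lambda>g. g <#\<^bsub>G\<^esub> N) gs) \<and>
      minimum_generating_set (G Mod N) (set (map (\<lambda>g. g <#\<^bsub>G\<^esub> N) gs)) \<and>
      distinct ns \<and> set ns = N \<longrightarrow>
      (let P = find d (card N); \<rho> = (!) (gs @ ns) in
        set_procedure P \<subseteq> {..<d + card N} \<and>
        minimum_generating_set G (set (result G \<rho> P)) \<and>
        set (tested G \<rho> P) \<subseteq> tuples G d \<and>
        length (tested G \<rho> P) \<le> d * (card N - 1) + 1 \<and>
        (1 \<le> d \<longrightarrow> d * (card N - 1) + 1 \<le> d * card N))"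
proof (intro exI[of _ lifting_procedure] allI impI, elim conjE)
  fix G :: "('a, 'b) monoid_scheme" and N gs ns d
  assume "group G" and fin: "finite (carrier G)" and min: "minimal_normal_subgroup N G"
    and comm: "comm_group (G\<lparr>carrier := N\<rparr>)" and gs: "gs \<in> tuples G d"
    and dist: "distinct (map (\<lambda>g. g <#\<^bsub>G\<^esub> N) gs)"
    and mod: "minimum_generating_set (G Mod N) (set (map (\<lambda>g. g <#\<^bsub>G\<^esub> N) gs))"
    and ns: "distinct ns" "set ns = N"
  interpret abelian_minimal_normal N G
    using min fin comm_groupE(4)[OF comm]
    by (auto simp: abelian_minimal_normal_def abelian_minimal_normal_axioms_def
        minimal_normal_subgroup_def)
  let ?m = "card N"
  \<comment> \<open>Variables below \<open>d\<close> stand for the lifts, the following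
    \<open>card N\<close> ones for the elements of \<open>N\<close>.\<close>
  define \<rho> where "\<rho> = (!) (gs @ ns)"
  have len: "length gs = d" and gsc: "set gs \<subseteq> carrier G" using gs by (auto simp: tuples_def)
  have lns: "length ns = ?m" using ns distinct_card by fastforce
  have "finite N" using fin subset by (rule rev_finite_subset)
  have m2: "2 \<le> ?m"
  proof (rule ccontr)
    assume "\<not> 2 \<le> ?m"
    moreover have "?m \<noteq> 0" using \<open>finite N\<close> subgroup.one_closed[OF subgroup_axioms] by (metis card_0_eq empty_iff)
    ultimately have "?m = 1" by simp
    then show False using nontrivial subgroup.one_closed[OF subgroup_axioms] by (metis card_1_singletonE singletonD)
  qed
  have \<rho>gs: "map (eval_term G \<rho>) (map Var [0..<d]) = gs"
    using len by (intro nth_equalityI) (auto simp: \<rho>_def nth_append)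
  have q: "eval_term G \<rho> (quotient_term d j) = inv\<^bsub>G\<^esub> (ns ! 0) \<otimes>\<^bsub>G\<^esub> ns ! j" for j
    using len by (simp add: quotient_term_def \<rho>_def nth_append)
  have nsN: "ns ! j \<in> N" if "j < ?m" for j using that lns ns(2) nth_mem by metis
  have qN: "eval_term G \<rho> (quotient_term d j) \<in> N" if "j < ?m" for j
    unfolding q using nsN[OF that] nsN[of 0] m2 by simp
  have cand: "map (eval_term G \<rho>) ((map Var [0..<d])[i := Mult (Var i) (quotient_term d j)]) =
      gs[i := gs ! i \<otimes>\<^bsub>G\<^esub> eval_term G \<rho> (quotient_term d j)]" if "i < d" for i j
    unfolding map_update \<rho>gs using that len by (simp add: \<rho>_def nth_append)
  have ctup: "map (eval_term G \<rho>) ts \<in> tuples G d" if "ts \<in> set (candidates d ?m)" for ts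
  proof -
    consider "ts = map Var [0..<d]"
      | i j where "i < d" "j < ?m" "ts = (map Var [0..<d])[i := Mult (Var i) (quotient_term d j)]"
      using \<open>ts \<in> set (candidates d ?m)\<close> by (auto simp: set_candidates)
    then show ?thesis
    proof cases
      case 1
      then show ?thesis using \<rho>gs gs by simp
    next
      case 2
      have "gs ! i \<otimes>\<^bsub>G\<^esub> eval_term G \<rho> (quotient_term d j) \<in> carrier G"
        using qN[OF 2(2)] gsc len 2(1) nth_mem[of i gs] by (blast intro: mem_carrier m_closed)
      then show ?thesis
        unfolding 2(3) cand[OF 2(1)] using gsc len
          set_update_subset_insert[of gs i "gs ! i \<otimes>\<^bsub>G\<^esub> eval_term G \<rho> (quotient_term d j)"]
        by (auto simp: tuples_def)
    qed
  qed
  have gen: "generate G (set gs \<union> N) = carrier G"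
    using mod generate_Mod_iff[OF gsc] by (simp add: minimum_generating_set_def)
  \<comment> \<open>Distinctness of the cosets makes the size of the generating set of the quotient
    exactly \<open>d\<close>.\<close>
  have "gen_number (G Mod N) = d"
    using mod distinct_card[OF dist] len by (simp add: minimum_generating_set_def)
  then have d_le: "d \<le> gen_number G" using gen_number_Mod_le by simp
  have minimum: "minimum_generating_set G (set (result G \<rho> (lifting_procedure d ?m)))"
  proof (cases rule: result_first_generating[of "candidates d ?m" G \<rho>
        "map Var [0..<d] @ [quotient_term d 1]"])
    case (1 ts)
    have "length (map (eval_term G \<rho>) ts) \<le> gen_number G"
      using ctup[OF 1(1)] d_le by (simp add: tuples_def)
    then show ?thesis
      unfolding lifting_procedure_def 1(3) by (rule minimum_of_tuple[OF 1(2)])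
  next
    case 2
    have fail: "\<not> generating_set G (set gs)"
      using 2(1)[of "map Var [0..<d]"] \<rho>gs by (simp add: set_candidates del: map_map)
    have fail1: "\<not> generating_set G (set (gs[i := gs ! i \<otimes>\<^bsub>G\<^esub> n]))" if i: "i < d" and n: "n \<in> N" for i n
    proof -
      \<comment> \<open>Left translation by \<open>ns ! 0\<close> permutes \<open>N\<close>, so
        every \<open>n\<close> is the value of some \<open>quotient_term d j\<close>.\<close>
      have "ns ! 0 \<otimes>\<^bsub>G\<^esub> n \<in> N" using nsN[of 0] n m2 by simp
      then obtain j where j: "j < ?m" "ns ! j = ns ! 0 \<otimes>\<^bsub>G\<^esub> n"
        using ns(2) lns by (metis in_set_conv_nth)
      have nc: "n \<in> carrier G" and n0: "ns ! 0 \<in> carrier G" using n nsN[of 0] m2 by auto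
      have qn: "eval_term G \<rho> (quotient_term d j) = n"
        unfolding q j(2) using nc n0 by (simp add: m_assoc[symmetric])
      show ?thesis
      proof (cases "j = 0")
        \<comment> \<open>Here \<open>n\<close> is the identity, and the failure is that of the
          unmodified tuple.\<close>
        case True
        then have "n = \<one>\<^bsub>G\<^esub>" using qn q[of 0] n0 by simp
        moreover have "gs ! i \<in> carrier G" using gsc len i by auto
        ultimately show ?thesis using fail by simp
      next
        case False
        then have "(map Var [0..<d])[i := Mult (Var i) (quotient_term d j)] \<in> set (candidates d ?m)"
          using i j(1) by (force simp: set_candidates)
        from 2(1)[OF this] show ?thesis unfolding cand[OF i] qn .
      qed
    qed
    have "ns ! 1 \<noteq> ns ! 0" using ns(1) lns m2 by (simp add: nth_eq_iff_index_eq)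
    moreover have "ns ! 0 \<in> carrier G" "ns ! 1 \<in> carrier G" using nsN[of 0] nsN[of 1] m2 by auto
    ultimately have "eval_term G \<rho> (quotient_term d 1) \<noteq> \<one>\<^bsub>G\<^esub>"
      unfolding q by (metis inv_equality inv_inv inv_closed)
    from minimum_of_extra_element[OF gs gen d_le fail fail1 qN this] m2
    have "minimum_generating_set G (set (gs @ [eval_term G \<rho> (quotient_term d 1)]))" by simp
    then show ?thesis unfolding lifting_procedure_def 2(2) map_append \<rho>gs by simp
  qed
  have "set (tested G \<rho> (lifting_procedure d ?m)) \<subseteq> tuples G d"
    using set_tested_first_generating[of G \<rho> "candidates d ?m"] ctup
    unfolding lifting_procedure_def by blast
  moreover have "length (tested G \<rho> (lifting_procedure d ?m)) \<le> d * (?m - 1) + 1"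
    using length_tested_first_generating[of G \<rho> "candidates d ?m"]
    unfolding lifting_procedure_def length_candidates .
  \<comment> \<open>For \<open>d = 0\<close> the left side is 1 and the right side 0, whence the
    condition on \<open>d\<close>.\<close>
  moreover have "d * (?m - 1) + 1 \<le> d * ?m" if "1 \<le> d"
    using that m2 by (cases ?m) auto
  ultimately show "let P = lifting_procedure d ?m; \<rho> = (!) (gs @ ns) in
        set_procedure P \<subseteq> {..<d + ?m} \<and>
        minimum_generating_set G (set (result G \<rho> P)) \<and>
        set (tested G \<rho> P) \<subseteq> tuples G d \<and>
        length (tested G \<rho> P) \<le> d * (?m - 1) + 1 \<and>
        (1 \<le> d \<longrightarrow> d * (?m - 1) + 1 \<le> d * ?m)"
    using set_lifting_procedure[OF m2] minimum unfolding \<rho>_def[symmetric] Let_def by blast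
qed

end
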